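(* Let $G$ and $H$ be connected graphs, with $n(G)$ and $n(H)$ vertices respectively. If $H$ has a universal vertex and $n(H)\geq \left\lceil \frac{n(G)}{3}+2\right\rceil$, and $v\in V(G)$, then the universally-identifying graph $G_v\ast H$ satisfies $\gamma_t(G_v\ast H)\leq a(G_v\ast H)+1$.
   Context: All graphs are finite and simple. $m(G)$ denotes the number of edges of $G$. A total dominating set of $G$ is a set $D\subseteq V(G)$ such that every vertex of $V(G)$ has a neighbor in $D$; the total domination number $\gamma_t(G)$ is the minimum cardinality of a total dominating set of $G$. If $d_1\leq d_2\leq\cdots\leq d_n$ is the ordered degree sequence of $G$, the annihilation number $a(G)$ is the largest integer $k$ with $k\le n$ such that $\sum_{i=1}^{k} d_i\leq m(G)$. A universal vertex of a graph is a vertex adjacent to all other vertices. For a connected graph $G$ with $v\in V(G)$ and another graph $H$ (disjoint from $G$) containing a universal vertex, the universally-identifying graph $G_v\ast H$ is obtained by identifying the vertex $v$ of $G$ with the universal vertex of $H$; it has $n(G)+n(H)-1$ vertices. *)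

theory Defs
  imports Complex_Main "HOL-Library.Multiset"
begin

record 'a graph =
  verts :: "'a set"
  edges :: "'a set set"

definition simple_graph :: "'a graph \<Rightarrow> bool" where
  "simple_graph G \<longleftrightarrow> finite (verts G) \<and> (\<forall>e\<in>edges G. e \<subseteq> verts G \<and> card e = 2)"

definition adj :: "'a graph \<Rightarrow> 'a \<Rightarrow> 'a \<Rightarrow> bool" where
  "adj G x y \<longleftrightarrow> {x, y} \<in> edges G"

text \<open>The graph without vertices does not count as connected.\<close>

definition connected_graph :: "'a graph \<Rightarrow> bool" where
  "connected_graph G \<longleftrightarrow>
     verts G \<noteq> {} \<and> (\<forall>x\<in>verts G. \<forall>y\<in>verts G. (adj G)\<^sup>*\<^sup>* x y)"

definition degree :: "'a graph \<Rightarrow> 'a \<Rightarrow> nat" where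
  "degree G x = card {y \<in> verts G. adj G x y}"

definition degree_sequence :: "'a graph \<Rightarrow> nat list" where
  "degree_sequence G =
     sorted_list_of_multiset (image_mset (degree G) (mset_set (verts G)))"

definition annihilation_number :: "'a graph \<Rightarrow> nat" where
  "annihilation_number G =
     Max {k. k \<le> card (verts G) \<and> sum_list (take k (degree_sequence G)) \<le> card (edges G)}"

definition total_dominating_set :: "'a graph \<Rightarrow> 'a set \<Rightarrow> bool" where
  "total_dominating_set G D \<longleftrightarrow> D \<subseteq> verts G \<and> (\<forall>x\<in>verts G. \<exists>y\<in>D. adj G x y)"

text \<open>A total dominating set exists iff there are no isolated vertices; otherwise the value
  below is unspecified.\<close>

definition total_domination_number :: "'a graph \<Rightarrow> nat" where
  "total_domination_number G = Min (card ` {D. total_dominating_set G D})"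

definition universal_vertex :: "'a graph \<Rightarrow> 'a \<Rightarrow> bool" where
  "universal_vertex G u \<longleftrightarrow> u \<in> verts G \<and> (\<forall>x\<in>verts G - {u}. adj G u x)"

text \<open>For disjoint graphs \<open>G\<close> and \<open>H\<close>, the vertex \<open>u\<close> of \<open>H\<close> is identified with the vertex
  \<open>v\<close> of \<open>G\<close> by renaming \<open>u\<close> to \<open>v\<close> throughout \<open>H\<close> and then taking the union.\<close>

definition identify_graph :: "'a graph \<Rightarrow> 'a \<Rightarrow> 'a graph \<Rightarrow> 'a \<Rightarrow> 'a graph" where
  "identify_graph G v H u =
     \<lparr>verts = verts G \<union> id(u := v) ` verts H,
      edges = edges G \<union> (\<lambda>e. id(u := v) ` e) ` edges H\<rparr>"

lemma verts_identify_graph: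
  assumes "v \<in> verts G" "u \<in> verts H"
  shows "verts (identify_graph G v H u) = verts G \<union> (verts H - {u})"
  using assms by (auto simp: identify_graph_def)

lemma card_verts_identify_graph:
  assumes "simple_graph G" "simple_graph H" "verts G \<inter> verts H = {}"
    and "v \<in> verts G" "u \<in> verts H"
  shows "card (verts (identify_graph G v H u)) = card (verts G) + card (verts H) - 1"
proof -
  have fin: "finite (verts G)" "finite (verts H)"
    using assms by (auto simp: simple_graph_def)
  have "card (verts G \<union> (verts H - {u})) = card (verts G) + card (verts H - {u})"
    using fin assms(3) by (intro card_Un_disjoint) auto
  moreover have "card (verts H) > 0"
    using fin assms(5) card_gt_0_iff by blast
  ultimately show ?thesis
    using assms(4,5) fin by (simp add: verts_identify_graph)
qed

lemma simple_graph_identify_graph: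
  assumes "simple_graph G" "simple_graph H" "verts G \<inter> verts H = {}"
    and "v \<in> verts G" "u \<in> verts H"
  shows "simple_graph (identify_graph G v H u)"
proof -
  have inj: "inj_on (id(u := v)) (verts H)"
    using assms(3,4) by (auto simp: inj_on_def)
  have "f ` e \<subseteq> f ` verts H \<and> card (f ` e) = 2"
    if e: "e \<in> edges H" and f: "f = id(u := v)" for e f
  proof -
    have "e \<subseteq> verts H" "card e = 2"
      using assms(2) e by (simp_all add: simple_graph_def)
    moreover from this have "inj_on f e"
      using inj inj_on_subset unfolding f by blast
    ultimately show ?thesis
      by (metis card_image image_mono)
  qed
  then show ?thesis
    using assms(1,2) unfolding simple_graph_def identify_graph_def
    by (simp add: ball_Un le_supI1 le_supI2)
qed

end

theory Submission
  imports Defs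
begin

text \<open>
  Write \<open>J\<close> for the identified graph, \<open>n\<close> for the order of \<open>G\<close> and \<open>N\<close> for the order of \<open>J\<close>.

  The annihilation number of any graph of order \<open>N\<close> is at least \<open>N div 2\<close>: the smaller half of
  the degrees sums to at most half of the total degree, which is the number of edges
  (\<open>annihilation_number_ge_half\<close>). By the hypothesis on the order of \<open>H\<close>,
  \<open>N \<ge> 4 * n / 3 + 1\<close>, and so \<open>annihilation_number J \<ge> 2 * n / 3\<close>.

  On the other side, a total dominating set of \<open>G\<close> that contains \<open>v\<close> is already totally dominating
  in \<open>J\<close>, because \<open>v\<close> has become adjacent to all the new vertices. So it is enough that \<open>G\<close>, if it
  has at least two vertices, has such a set with at most \<open>2 * n / 3 + 1\<close> elements
  (\<open>total_dominating_set_through_vertex\<close>); for \<open>n = 1\<close>, the vertex \<open>v\<close> and any other vertex of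
  \<open>J\<close> do. To find the set in \<open>G\<close>, sort the vertices by their distance from
  \<open>v\<close> modulo 3. Two cyclically consecutive classes nearly form a total dominating set: a vertex
  other than \<open>v\<close> in the second class or in the omitted one is dominated by a neighbour one step
  closer to \<open>v\<close>, and a vertex \<open>x\<close> in the first class is dominated by a neighbour one step further
  away, if there is one. If there is none, nobody depends on \<open>x\<close>, and \<open>x\<close> can be exchanged for a
  neighbour closer to \<open>v\<close>, which then dominates it. At most one
  more vertex is needed around \<open>v\<close> itself. The three choices of two classes together contain every
  vertex twice, so the cheapest has at most \<open>2 * n / 3\<close> elements.
\<close>

section \<open>Adjacency, degrees and the annihilation number\<close>

lemma adj_commute: "adj G x y \<longleftrightarrow> adj G y x"
  by (simp add: adj_def insert_commute)

lemma adj_simple_graphD: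
  assumes "simple_graph G" and "adj G x y"
  shows "x \<in> verts G" and "y \<in> verts G" and "x \<noteq> y"
  using assms unfolding simple_graph_def adj_def by fastforce+

lemma finite_edges:
  assumes "simple_graph G"
  shows "finite (edges G)"
proof (rule finite_subset)
  show "edges G \<subseteq> Pow (verts G)" and "finite (Pow (verts G))"
    using assms by (auto simp: simple_graph_def)
qed

lemma degree_eq_card_incident_edges:
  assumes "simple_graph G"
  shows "degree G x = card {e \<in> edges G. x \<in> e}"
proof -
  have "bij_betw (\<lambda>y. {x, y}) {y \<in> verts G. adj G x y} {e \<in> edges G. x \<in> e}"
    unfolding bij_betw_def
  proof
    show "inj_on (\<lambda>y. {x, y}) {y \<in> verts G. adj G x y}"
      by (auto simp: inj_on_def doubleton_eq_iff)
    show "(\<lambda>y. {x, y}) ` {y \<in> verts G. adj G x y} = {e \<in> edges G. x \<in> e}"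
    proof (intro equalityI subsetI)
      fix e assume e: "e \<in> {e \<in> edges G. x \<in> e}"
      then have "card e = 2" and sub: "e \<subseteq> verts G"
        using assms by (auto simp: simple_graph_def)
      then obtain y where "e = {x, y}"
        using e by (auto simp: card_2_iff)
      then show "e \<in> (\<lambda>y. {x, y}) ` {y \<in> verts G. adj G x y}"
        using e sub by (auto simp: adj_def)
    qed (auto simp: adj_def)
  qed
  then show ?thesis
    by (simp add: degree_def bij_betw_same_card)
qed

lemma sum_degree:
  assumes "simple_graph G"
  shows "(\<Sum>x\<in>verts G. degree G x) = 2 * card (edges G)"
proof -
  have fin: "finite (verts G)"
    using assms by (simp add: simple_graph_def)
  have "card {x \<in> verts G. x \<in> e} = 2" if "e \<in> edges G" for e
  proof -
    have "{x \<in> verts G. x \<in> e} = e" and "card e = 2"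
      using assms that by (auto simp: simple_graph_def)
    then show ?thesis by simp
  qed
  then show ?thesis
    using sum_multicount[OF fin finite_edges[OF assms], where R = "(\<in>)" and k = 2]
    by (simp add: degree_eq_card_incident_edges[OF assms])
qed

lemma sum_list_take_half_sorted:
  fixes xs :: "nat list"
  assumes "sorted xs" and "2 * k \<le> length xs"
  shows "2 * sum_list (take k xs) \<le> sum_list xs"
proof -
  have "sum_list (take k xs) \<le> sum_list (take k (drop k xs))"
    using assms by (intro sum_list_mono2) (auto intro: sorted_nth_mono)
  moreover have "sum_list xs = sum_list (take k xs) + sum_list (take k (drop k xs))
      + sum_list (drop k (drop k xs))"
    by (metis add.assoc append_take_drop_id sum_list_append)
  ultimately show ?thesis by linarith
qed

lemma annihilation_number_ge_half:
  assumes "simple_graph G"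
  shows "card (verts G) div 2 \<le> annihilation_number G"
proof -
  let ?ds = "degree_sequence G"
  have mset: "mset ?ds = image_mset (degree G) (mset_set (verts G))"
    by (simp add: degree_sequence_def)
  have "length ?ds = card (verts G)"
    using arg_cong[OF mset, of size] by simp
  moreover have "sum_list ?ds = 2 * card (edges G)"
    using arg_cong[OF mset, of sum_mset] sum_degree[OF assms]
    by (simp add: sum_mset_sum_list sum_unfold_sum_mset)
  moreover have "sorted ?ds"
    by (simp add: degree_sequence_def)
  ultimately have "sum_list (take (card (verts G) div 2) ?ds) \<le> card (edges G)"
    using sum_list_take_half_sorted[of ?ds "card (verts G) div 2"] by simp
  then show ?thesis
    unfolding annihilation_number_def by (intro Max_ge) auto
qed

section \<open>Small total dominating sets through a given vertex\<close>

lemma total_domination_number_le_card: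
  assumes "simple_graph G" and "total_dominating_set G D"
  shows "total_domination_number G \<le> card D"
proof -
  have "{D. total_dominating_set G D} \<subseteq> Pow (verts G)"
    by (auto simp: total_dominating_set_def)
  then have "finite {D. total_dominating_set G D}"
    using assms(1) by (meson finite_Pow_iff finite_subset simple_graph_def)
  then show ?thesis
    using assms(2) unfolding total_domination_number_def by (intro Min_le) auto
qed

text \<open>The level of a vertex is its distance from \<open>v\<close>, and its parent is a neighbour one step closer.\<close>

lemma connected_graph_levels:
  assumes "simple_graph G" and "connected_graph G" and v: "v \<in> verts G"
  obtains lev :: "'a \<Rightarrow> nat" and p :: "'a \<Rightarrow> 'a"
  where "lev v = 0"
    and "\<And>x. x \<in> verts G - {v} \<Longrightarrow> adj G x (p x) \<and> lev x = Suc (lev (p x))"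
proof -
  define lev where "lev x = (LEAST k. (adj G ^^ k) v x)" for x
  have lev: "(adj G ^^ lev x) v x" if "x \<in> verts G" for x
  proof -
    have "(adj G)\<^sup>*\<^sup>* v x"
      using assms that by (simp add: connected_graph_def)
    then obtain k where "(adj G ^^ k) v x"
      using rtranclp_imp_relpowp[of "adj G" v x] by auto
    then show ?thesis unfolding lev_def by (rule LeastI)
  qed
  have lev_le: "lev x \<le> k" if "(adj G ^^ k) v x" for x k
    using that unfolding lev_def by (rule Least_le)
  have "\<exists>y. adj G x y \<and> lev x = Suc (lev y)" if x: "x \<in> verts G - {v}" for x
  proof (cases "lev x")
    case 0
    then show ?thesis using lev[of x] x by simp
  next
    case (Suc k)
    then obtain y where y: "(adj G ^^ k) v y" "adj G y x"
      using lev[of x] x by auto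
    then have "y \<in> verts G"
      using adj_simple_graphD[OF assms(1)] by blast
    then have "(adj G ^^ Suc (lev y)) v x"
      using lev y(2) by auto
    then have "lev x \<le> Suc (lev y)" by (rule lev_le)
    moreover have "lev y \<le> k" using lev_le y(1) .
    ultimately show ?thesis
      using Suc y(2) adj_commute by (metis Suc_le_mono le_antisym)
  qed
  then obtain p where "\<And>x. x \<in> verts G - {v} \<Longrightarrow> adj G x (p x) \<and> lev x = Suc (lev (p x))"
    by metis
  moreover have "lev v = 0"
    using lev_le[of 0 v] by simp
  ultimately show thesis using that by blast
qed

lemma mod_3_cases:
  fixes a :: nat
  shows "a mod 3 = 0 \<or> a mod 3 = 1 \<or> a mod 3 = 2"
  by linarith

lemma Suc_mod_3_cong: "Suc a mod 3 = Suc b mod 3 \<longleftrightarrow> a mod 3 = b mod 3"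
  using mod_3_cases[of a] mod_3_cases[of b] by (auto simp: mod_Suc)

text \<open>
  A vertex of the class of \<open>i\<close> without a neighbour on the next level is exchanged for its parent.
  This does not increase the size, and it cannot harm any other vertex, since the vertices of the
  class of \<open>i\<close> serve only to dominate their neighbours on the next level. The root \<open>v\<close> has no parent
  and needs care: for each \<open>i\<close>, the set obtained contains \<open>v\<close> or its neighbour \<open>w\<close>, so adding both
  costs at most one vertex.
\<close>

lemma total_dominating_set_from_level_classes:
  fixes G :: "'a graph" and lev :: "'a \<Rightarrow> nat"
  assumes G: "simple_graph G" and v: "lev v = 0" and w: "adj G v w" "lev w = 1"
    and p: "\<And>x. x \<in> verts G - {v} \<Longrightarrow> adj G x (p x) \<and> lev x = Suc (lev (p x))"
  obtains D where "total_dominating_set G D" and "v \<in> D"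
    and "card D \<le> card {x \<in> verts G. lev x mod 3 = i mod 3}
                  + card {x \<in> verts G. lev x mod 3 = Suc i mod 3} + 1"
proof -
  define A where "A = {x \<in> verts G. lev x mod 3 = i mod 3}"
  define B where "B = {x \<in> verts G. lev x mod 3 = Suc i mod 3}"
  define parental where "parental x \<longleftrightarrow> (\<exists>y. adj G x y \<and> lev y = Suc (lev x))" for x
  define q where "q x = (if parental x then x else p x)" for x
  define D\<^sub>0 where "D\<^sub>0 = B \<union> q ` A"
  have fin: "finite A" "finite B"
    using G by (auto simp: A_def B_def simple_graph_def)
  have vw: "v \<in> verts G" "w \<in> verts G" "v \<noteq> w"
    using adj_simple_graphD[OF G w(1)] by auto
  have parental_v: "parental v"
    using v w by (auto simp: parental_def)
  have p_verts: "p x \<in> verts G" if "x \<in> verts G - {v}" for x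
    using p[OF that] adj_simple_graphD[OF G] by blast
  have "q x \<in> verts G" if "x \<in> A" for x
    using that p_verts parental_v unfolding q_def A_def by (cases "x = v") auto
  then have D\<^sub>0_verts: "D\<^sub>0 \<subseteq> verts G"
    by (auto simp: D\<^sub>0_def B_def)
  have dom: "\<exists>y\<in>D\<^sub>0. adj G x y" if x: "x \<in> verts G - {v}" for x
  proof -
    note px = p[OF x] p_verts[OF x]
    have "lev x mod 3 = i mod 3 \<or> lev x mod 3 = Suc i mod 3 \<or> lev x mod 3 = Suc (Suc i) mod 3"
      using mod_3_cases[of i] mod_3_cases[of "lev x"] by (auto simp: mod_Suc)
    then consider "lev x mod 3 = i mod 3" | "lev x mod 3 = Suc i mod 3"
      | "lev x mod 3 = Suc (Suc i) mod 3" by blast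
    then show ?thesis
    proof cases
      case 1
      show ?thesis
      proof (cases "parental x")
        case True
        then obtain y where y: "adj G x y" "lev y = Suc (lev x)"
          by (auto simp: parental_def)
        have "lev y mod 3 = Suc i mod 3"
          using 1 y(2) by (simp add: Suc_mod_3_cong)
        then have "y \<in> B"
          using adj_simple_graphD(2)[OF G y(1)] by (simp add: B_def)
        then show ?thesis using y(1) by (auto simp: D\<^sub>0_def)
      next
        case False
        then have "q x = p x" by (simp add: q_def)
        moreover have "x \<in> A" using 1 x by (simp add: A_def)
        ultimately have "p x \<in> D\<^sub>0" by (force simp: D\<^sub>0_def)
        then show ?thesis using px by blast
      qed
    next
      case 2
      have "parental (p x)"
        using px adj_commute by (force simp: parental_def)
      then have "q (p x) = p x" by (simp add: q_def)
      moreover have "lev (p x) mod 3 = i mod 3"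
        using 2 px by (simp add: Suc_mod_3_cong)
      then have "p x \<in> A" using px by (simp add: A_def)
      ultimately have "p x \<in> D\<^sub>0" by (force simp: D\<^sub>0_def)
      then show ?thesis using px by blast
    next
      case 3
      have "lev (p x) mod 3 = Suc i mod 3"
        using 3 px by (simp add: Suc_mod_3_cong)
      then have "p x \<in> D\<^sub>0" using px by (simp add: B_def D\<^sub>0_def)
      then show ?thesis using px by blast
    qed
  qed
  have v_or_w: "v \<in> D\<^sub>0 \<or> w \<in> D\<^sub>0"
  proof -
    have "i mod 3 = 0 \<or> Suc i mod 3 = 0 \<or> i mod 3 = 1"
      using mod_3_cases[of i] by (auto simp: mod_Suc)
    then show ?thesis
    proof (elim disjE)
      assume "i mod 3 = 0"
      then have "v \<in> A" using v vw by (simp add: A_def)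
      moreover have "q v = v" using parental_v by (simp add: q_def)
      ultimately show ?thesis by (force simp: D\<^sub>0_def)
    next
      assume "Suc i mod 3 = 0"
      then show ?thesis using v vw by (simp add: B_def D\<^sub>0_def)
    next
      assume "i mod 3 = 1"
      then have "w \<in> A" using w vw by (simp add: A_def)
      then have "q w \<in> D\<^sub>0" by (simp add: D\<^sub>0_def)
      \<comment> \<open>Every vertex other than the root has positive level, so the parent of \<open>w\<close> is \<open>v\<close>.\<close>
      moreover have "p w = v"
        using p[of w] p[of "p w"] p_verts[of w] w(2) vw by fastforce
      ultimately show ?thesis by (auto simp: q_def split: if_splits)
    qed
  qed
  show thesis
  proof (rule that)
    show "total_dominating_set G (D\<^sub>0 \<union> {v, w})"
      using D\<^sub>0_verts vw dom w(1) unfolding total_dominating_set_def by blast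
    have "card (D\<^sub>0 \<union> {v, w}) \<le> card D\<^sub>0 + 1"
      using v_or_w
    proof
      assume "v \<in> D\<^sub>0"
      then have "D\<^sub>0 \<union> {v, w} = insert w D\<^sub>0" by auto
      then show ?thesis using fin by (simp add: D\<^sub>0_def card_insert_if)
    next
      assume "w \<in> D\<^sub>0"
      then have "D\<^sub>0 \<union> {v, w} = insert v D\<^sub>0" by auto
      then show ?thesis using fin by (simp add: D\<^sub>0_def card_insert_if)
    qed
    also have "card D\<^sub>0 \<le> card B + card A"
      unfolding D\<^sub>0_def using card_Un_le[of B "q ` A"] card_image_le[OF fin(1), of q] by linarith
    finally show "card (D\<^sub>0 \<union> {v, w}) \<le> card {x \<in> verts G. lev x mod 3 = i mod 3}
                  + card {x \<in> verts G. lev x mod 3 = Suc i mod 3} + 1"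
      by (simp add: A_def B_def)
  qed simp
qed

text \<open>
  The three pairs of consecutive level classes cover every vertex twice, so one of the three sets
  above has at most the average size.
\<close>

lemma total_dominating_set_through_vertex:
  assumes G: "simple_graph G" and con: "connected_graph G" and v: "v \<in> verts G"
    and two: "card (verts G) \<ge> 2"
  obtains D where "total_dominating_set G D" and "v \<in> D" and "3 * card D \<le> 2 * card (verts G) + 3"
proof -
  obtain lev :: "'a \<Rightarrow> nat" and p where lev: "lev v = 0"
    and p: "\<And>x. x \<in> verts G - {v} \<Longrightarrow> adj G x (p x) \<and> lev x = Suc (lev (p x))"
    using connected_graph_levels[OF G con v] by blast
  have fin: "finite (verts G)" using G by (simp add: simple_graph_def)
  obtain w where w: "adj G v w" "lev w = 1"
  proof -
    have "verts G - {v} \<noteq> {}"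
      using two card_mono[of "{v}" "verts G"] by auto
    then obtain w where w: "w \<in> verts G - {v}"
      and least: "\<And>y. y \<in> verts G - {v} \<Longrightarrow> lev w \<le> lev y"
      using arg_min_if_finite[of "verts G - {v}" lev] fin by (metis finite_Diff not_le)
    have "p w \<in> verts G"
      using p[OF w] adj_simple_graphD[OF G] by blast
    \<comment> \<open>The parent of \<open>w\<close> has a smaller level, which by minimality only \<open>v\<close> can have.\<close>
    then have "p w = v"
      using least[of "p w"] p[OF w] by fastforce
    then show thesis
      using that p[OF w] lev adj_commute by fastforce
  qed
  define c where "c i = card {x \<in> verts G. lev x mod 3 = i}" for i
  have from_classes: "\<exists>D. total_dominating_set G D \<and> v \<in> D
      \<and> card D \<le> c (i mod 3) + c (Suc i mod 3) + 1" for i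
  proof (rule total_dominating_set_from_level_classes[OF G lev w, of p i])
    show "adj G x (p x) \<and> lev x = Suc (lev (p x))" if "x \<in> verts G - {v}" for x
      using p[OF that] .
  qed (auto simp: c_def)
  obtain D\<^sub>0 where D\<^sub>0: "total_dominating_set G D\<^sub>0" "v \<in> D\<^sub>0" "card D\<^sub>0 \<le> c 0 + c 1 + 1"
    using from_classes[of 0] by auto
  obtain D\<^sub>1 where D\<^sub>1: "total_dominating_set G D\<^sub>1" "v \<in> D\<^sub>1" "card D\<^sub>1 \<le> c 1 + c 2 + 1"
    using from_classes[of 1] by (auto simp: numeral_2_eq_2)
  obtain D\<^sub>2 where D\<^sub>2: "total_dominating_set G D\<^sub>2" "v \<in> D\<^sub>2" "card D\<^sub>2 \<le> c 2 + c 0 + 1"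
    using from_classes[of 2] by auto
  have "card (verts G) = (\<Sum>i\<in>{..<3}. c i)"
  proof -
    have "verts G = (\<Union>i\<in>{..<3}. {x \<in> verts G. lev x mod 3 = i})" by auto
    then show ?thesis
      unfolding c_def using fin by (subst card_UN_disjoint[symmetric]) auto
  qed
  also have "\<dots> = c 0 + c 1 + c 2"
    by (simp add: numeral_eq_Suc)
  finally have "3 * card D\<^sub>0 \<le> 2 * card (verts G) + 3 \<or> 3 * card D\<^sub>1 \<le> 2 * card (verts G) + 3
      \<or> 3 * card D\<^sub>2 \<le> 2 * card (verts G) + 3"
    using D\<^sub>0(3) D\<^sub>1(3) D\<^sub>2(3) by linarith
  then show thesis
    using that D\<^sub>0 D\<^sub>1 D\<^sub>2 by blast
qed

section \<open>Identifying a vertex with a universal vertex\<close>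

lemma adj_identify_graph_left:
  assumes "adj G x y"
  shows "adj (identify_graph G v H u) x y"
  using assms by (simp add: adj_def identify_graph_def)

lemma adj_identify_graph_universal:
  assumes "universal_vertex H u" and "x \<in> verts H - {u}"
  shows "adj (identify_graph G v H u) x v"
proof -
  have "{u, x} \<in> edges H"
    using assms by (simp add: universal_vertex_def adj_def)
  then have "id(u := v) ` {u, x} \<in> (\<lambda>e. id(u := v) ` e) ` edges H"
    by (rule imageI)
  then have "id(u := v) ` {u, x} \<in> edges (identify_graph G v H u)"
    by (simp only: identify_graph_def graph.simps UnI2)
  moreover have "id(u := v) ` {u, x} = {x, v}"
    using assms(2) by auto
  ultimately show ?thesis by (simp add: adj_def)
qed

theorem proposition3p5:
  fixes G H :: "'a graph" and v u :: 'a
  assumes "simple_graph G" and "simple_graph H"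
    and "connected_graph G" and "connected_graph H"
    and "verts G \<inter> verts H = {}"
    and "universal_vertex H u"
    and "int (card (verts H)) \<ge> \<lceil>real (card (verts G)) / 3 + 2\<rceil>"
    and "v \<in> verts G"
  shows "total_domination_number (identify_graph G v H u)
           \<le> annihilation_number (identify_graph G v H u) + 1"
proof -
  let ?J = "identify_graph G v H u"
  let ?n = "card (verts G)" and ?h = "card (verts H)"
  have u: "u \<in> verts H"
    using assms(6) by (simp add: universal_vertex_def)
  have J: "simple_graph ?J"
    using simple_graph_identify_graph[OF assms(1,2,5,8) u] .
  have verts_J: "verts ?J = verts G \<union> (verts H - {u})"
    using verts_identify_graph[OF assms(8) u] .
  have card_J: "card (verts ?J) = ?n + ?h - 1"
    using card_verts_identify_graph[OF assms(1,2,5,8) u] .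
  have "real ?n / 3 + 2 \<le> real ?h"
    using assms(7) by linarith
  then have order_H: "?n + 6 \<le> 3 * ?h" by linarith
  have "?n > 0"
    using assms(1,8) card_gt_0_iff simple_graph_def by blast
  have half: "(?n + ?h - 1) div 2 \<le> annihilation_number ?J"
    using annihilation_number_ge_half[OF J] card_J by simp
  obtain D where D: "total_dominating_set ?J D" and card_D: "card D \<le> (?n + ?h - 1) div 2 + 1"
  proof (cases "?n \<ge> 2")
    case True
    then obtain D where D: "total_dominating_set G D" "v \<in> D" "3 * card D \<le> 2 * ?n + 3"
      using total_dominating_set_through_vertex[OF assms(1,3,8)] by blast
    have "\<exists>y\<in>D. adj ?J x y" if "x \<in> verts ?J" for x
    proof (cases "x \<in> verts G")
      case True
      then show ?thesis
        using D(1) adj_identify_graph_left unfolding total_dominating_set_def by metis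
    next
      case False
      then show ?thesis
        using that verts_J D(2) adj_identify_graph_universal[OF assms(6)] by blast
    qed
    then have "total_dominating_set ?J D"
      using D(1) verts_J by (auto simp: total_dominating_set_def)
    moreover have "card D \<le> (?n + ?h - 1) div 2 + 1"
      using D(3) order_H by linarith
    ultimately show thesis by (rule that)
  next
    case False
    \<comment> \<open>Now \<open>G\<close> is the single vertex \<open>v\<close>, and \<open>v\<close> has to be dominated from \<open>H\<close>.\<close>
    have "?n = 1" using False \<open>?n > 0\<close> by linarith
    then have G: "verts G = {v}"
      using assms(8) by (metis card_1_singletonE singletonD)
    have "?h \<ge> 3" using order_H \<open>?n > 0\<close> by linarith
    then have "verts H \<noteq> {u}" by auto
    then obtain w where w: "w \<in> verts H - {u}" using u by blast
    note vx = adj_identify_graph_universal[OF assms(6), of _ G v]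
    have "total_dominating_set ?J {v, w}"
      unfolding total_dominating_set_def
      using vx w verts_J G adj_commute[of ?J v w] by auto
    moreover have "card {v, w} \<le> (?n + ?h - 1) div 2 + 1"
      using \<open>?h \<ge> 3\<close> \<open>?n = 1\<close> card_insert_le_m1[of 2 "{w}" v] by simp
    ultimately show thesis by (rule that)
  qed
  have "total_domination_number ?J \<le> card D"
    using total_domination_number_le_card[OF J D] .
  then show ?thesis
    using card_D half by linarith
qed

end
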